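(* Let $X$ be a Hausdorff Lindelöf $P$-space which is Whyburn, and let $Y$ be a Hausdorff Lindelöf $P$-space which is weakly Whyburn. Then the product space $X\times Y$ is weakly Whyburn.
   Context: A $P$-space is a topological space in which every $G_\delta$ set is open. A set $F\subseteq X$ is an almost closed set converging to $x\in X$, written $F\to x$, if $\overline{F}\setminus F=\{x\}$. A space $X$ is Whyburn if for each non-closed set $A\subseteq X$ and each point $x\in\overline{A}\setminus A$ there is $F\subseteq A$ with $F\to x$; it is weakly Whyburn if for each non-closed set $A\subseteq X$ there are some point $x\in\overline{A}\setminus A$ and some $F\subseteq A$ with $F\to x$. A space is Lindelöf if every open cover has a countable subcover. *)

theory Defs
  imports "HOL-Analysis.Analysis"
begin

definition P_space :: "'a topology \<Rightarrow> bool" where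
  "P_space X \<longleftrightarrow> (\<forall>S. gdelta_in X S \<longrightarrow> openin X S)"

definition almost_closed_to :: "'a topology \<Rightarrow> 'a set \<Rightarrow> 'a \<Rightarrow> bool" where
  "almost_closed_to X F x \<longleftrightarrow> F \<subseteq> topspace X \<and> X closure_of F - F = {x}"

definition Whyburn_space :: "'a topology \<Rightarrow> bool" where
  "Whyburn_space X \<longleftrightarrow>
     (\<forall>A. A \<subseteq> topspace X \<and> \<not> closedin X A \<longrightarrow>
        (\<forall>x \<in> X closure_of A - A. \<exists>F \<subseteq> A. almost_closed_to X F x))"

definition weakly_Whyburn_space :: "'a topology \<Rightarrow> bool" where
  "weakly_Whyburn_space X \<longleftrightarrow>
     (\<forall>A. A \<subseteq> topspace X \<and> \<not> closedin X A \<longrightarrow>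
        (\<exists>x \<in> X closure_of A - A. \<exists>F \<subseteq> A. almost_closed_to X F x))"

end

theory Submission
  imports Defs
begin

text \<open>
  Call an uncountable set thin at \<open>p\<close> if none of its subsets accumulates at a point other than \<open>p\<close>.
  In a Lindelof Hausdorff Whyburn P-space, every set \<open>P\<close> with a point \<open>x \<notin> P\<close> in its closure
  contains a set thin at \<open>x\<close>; in the weakly Whyburn case, every uncountable set contains a set thin
  at some point, because it contains a non-closed set of cardinality \<open>\<aleph>\<^sub>1\<close>.

  Let \<open>(x, y)\<close> be in the closure of \<open>A\<close> but not in \<open>A\<close>. If the section of \<open>A\<close> at \<open>x\<close> is not
  closed, the weak Whyburn property of \<open>Y\<close> suffices. Otherwise take a clopen \<open>V\<close> around \<open>y\<close> missing
  this section, a set \<open>D\<close> thin at \<open>x\<close> in the projection of \<open>A \<inter> (X \<times> V)\<close>, and points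
  \<open>(d, f d)\<close> of \<open>A \<inter> (X \<times> V)\<close> for \<open>d \<in> D\<close>. Either \<open>f\<close> is constant on an uncountable subset of \<open>D\<close>,
  or \<open>f ` D\<close> contains a set thin at some \<open>z \<in> V\<close>, and the graph of an inverse of \<open>f\<close> over that set
  accumulates only at \<open>(x, z)\<close>.
\<close>

section \<open>Lindelof P-spaces\<close>

text \<open>The factor \<open>topspace X\<close> serves the empty index set, where the bare
  intersection would be \<open>UNIV\<close>.\<close>

lemma openin_P_space_INT:
  assumes "P_space X" "countable I" "\<And>i. i \<in> I \<Longrightarrow> openin X (U i)"
  shows "openin X (topspace X \<inter> (\<Inter>i\<in>I. U i))"
proof (cases "I = {}")
  case False
  have "gdelta_in X (\<Inter>(U ` I))"
    using assms False by (intro gdelta_in_Inter) (auto intro: open_imp_gdelta_in)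
  with assms show ?thesis
    unfolding P_space_def by (simp add: openin_Int)
qed simp

lemma closedin_P_space_UN:
  assumes "P_space X" "countable I" "\<And>i. i \<in> I \<Longrightarrow> closedin X (C i)"
  shows "closedin X (\<Union>i\<in>I. C i)"
proof -
  have "openin X (topspace X \<inter> (\<Inter>i\<in>I. topspace X - C i))"
    using assms by (intro openin_P_space_INT) auto
  moreover have "topspace X \<inter> (\<Inter>i\<in>I. topspace X - C i) = topspace X - (\<Union>i\<in>I. C i)"
    by auto
  ultimately show ?thesis
    using assms(3) by (auto simp: closedin_def)
qed

text \<open>The argument for compact sets with "countable" in place of "finite": \<open>C\<close> is
  Lindelof, and in a P-space countably many neighbourhoods of \<open>x\<close> still have an open
  intersection.\<close>

lemma Lindelof_P_space_closed_separation:
  assumes X: "Hausdorff_space X" "Lindelof_space X" "P_space X"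
    and C: "closedin X C" and x: "x \<in> topspace X - C"
  obtains W where "openin X W" "x \<in> W" "X closure_of W \<inter> C = {}"
proof -
  have "\<exists>U W. openin X U \<and> openin X W \<and> c \<in> U \<and> x \<in> W \<and> disjnt U W" if "c \<in> C" for c
    using X(1) x that closedin_subset[OF C] unfolding Hausdorff_space_def by (metis DiffD1 DiffD2 subsetD)
  then obtain U W where UW: "\<And>c. c \<in> C \<Longrightarrow> openin X (U c) \<and> openin X (W c) \<and> c \<in> U c \<and> x \<in> W c \<and> disjnt (U c) (W c)"
    by metis
  have "\<forall>\<U>. (\<forall>U\<in>\<U>. openin X U) \<and> C \<subseteq> \<Union>\<U> \<longrightarrow> (\<exists>\<V>. countable \<V> \<and> \<V> \<subseteq> \<U> \<and> C \<subseteq> \<Union>\<V>)"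
    using Lindelof_space_closedin_subtopology[OF X(2) C]
    by (simp only: Lindelof_space_subtopology_subset[OF closedin_subset[OF C]])
  moreover have "(\<forall>V\<in>U ` C. openin X V) \<and> C \<subseteq> \<Union>(U ` C)" using UW by auto
  ultimately have "\<exists>\<V>. countable \<V> \<and> \<V> \<subseteq> U ` C \<and> C \<subseteq> \<Union>\<V>" by blast
  then obtain I where I: "countable I" "I \<subseteq> C" "C \<subseteq> \<Union>(U ` I)"
    by (metis countable_subset_image)
  let ?W = "topspace X \<inter> (\<Inter>c\<in>I. W c)"
  \<comment> \<open>An open set disjoint from \<open>?W\<close> is also disjoint from its
    closure.\<close>
  have "openin X (\<Union>(U ` I))" using UW I by (intro openin_Union) auto
  moreover have "\<Union>(U ` I) \<inter> ?W = {}" using UW I by (fastforce simp: disjnt_iff)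
  ultimately have "\<Union>(U ` I) \<inter> X closure_of ?W = {}"
    by (simp only: openin_Int_closure_of_eq_empty)
  moreover have "openin X ?W" using UW I by (intro openin_P_space_INT X) auto
  moreover have "x \<in> ?W" using x UW I by auto
  ultimately show thesis using that[of ?W] I(3) by blast
qed

text \<open>Regularity gives a decreasing sequence of open neighbourhoods of \<open>x\<close>, each
  containing the closure of the next. Their intersection is open by the P-space property and closed
  because the closures have the same intersection.\<close>

lemma Lindelof_P_space_clopen_separation:
  assumes X: "Hausdorff_space X" "Lindelof_space X" "P_space X"
    and C: "closedin X C" and x: "x \<in> topspace X - C"
  obtains W where "openin X W" "closedin X W" "x \<in> W" "W \<inter> C = {}"
proof -
  have step: "\<exists>W. (openin X W \<and> x \<in> W) \<and> X closure_of W \<subseteq> V" if V: "openin X V \<and> x \<in> V" for V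
  proof -
    have "closedin X (topspace X - V)" "x \<in> topspace X - (topspace X - V)"
      using V openin_subset by fastforce+
    then obtain W where "openin X W" "x \<in> W" "X closure_of W \<inter> (topspace X - V) = {}"
      using Lindelof_P_space_closed_separation[OF X] by metis
    moreover have "X closure_of W \<subseteq> topspace X" by (simp add: closure_of_subset_topspace)
    ultimately show ?thesis by blast
  qed
  have "openin X (topspace X - C) \<and> x \<in> topspace X - C" using C x by auto
  then have "\<exists>g. \<forall>n::nat. (openin X (g n) \<and> x \<in> g n \<and> g n \<subseteq> topspace X - C) \<and> X closure_of g (Suc n) \<subseteq> g n"
  proof (intro dependent_nat_choice)
    fix V and n :: nat assume V: "openin X V \<and> x \<in> V \<and> V \<subseteq> topspace X - C"
    then obtain W where W: "openin X W" "x \<in> W" "X closure_of W \<subseteq> V" using step by blast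
    then have "W \<subseteq> V" using closure_of_subset[OF openin_subset[OF W(1)]] by blast
    with V W show "\<exists>W. (openin X W \<and> x \<in> W \<and> W \<subseteq> topspace X - C) \<and> X closure_of W \<subseteq> V"
      by (intro exI[of _ W]) auto
  qed auto
  then obtain g where g: "\<And>n::nat. openin X (g n)" "\<And>n. x \<in> g n" "\<And>n. g n \<subseteq> topspace X - C"
    "\<And>n. X closure_of g (Suc n) \<subseteq> g n"
    by metis
  have "g (Suc n) \<subseteq> X closure_of g (Suc n)" for n
    by (simp add: closure_of_subset g(1) openin_subset)
  with g(4) have "(\<Inter>n. g n) = (\<Inter>n. X closure_of g (Suc n))" by fast
  then have "closedin X (\<Inter>n. g n)" by auto
  moreover have "openin X (topspace X \<inter> (\<Inter>n. g n))"
    using g by (intro openin_P_space_INT X) auto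
  moreover have "topspace X \<inter> (\<Inter>n. g n) = (\<Inter>n. g n)" using g(3) by blast
  moreover have "x \<in> (\<Inter>n. g n)" "(\<Inter>n. g n) \<inter> C = {}" using g(2,3) by blast+
  ultimately show thesis using that[of "\<Inter>n. g n"] by simp
qed

text \<open>Such a \<open>D\<close> is closed and discrete. Each open set \<open>N d\<close> meets
  \<open>D\<close> only in \<open>d\<close>, so a countable subcover can omit no index.\<close>

lemma Lindelof_space_discrete_closed_countable:
  assumes "Lindelof_space X" and D: "\<And>D'. D' \<subseteq> D \<Longrightarrow> closedin X D'"
  shows "countable D"
proof (cases "D = {}")
  case False
  define N where "N d = topspace X - (D - {d})" for d
  have sub: "D \<subseteq> topspace X" using D[of D] closedin_subset by auto
  have "\<exists>\<V>. countable \<V> \<and> \<V> \<subseteq> N ` D \<and> \<Union>\<V> = topspace X"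
    using False sub by (intro Lindelof_spaceD[OF assms(1)]) (auto simp: N_def intro!: D)
  then obtain I where "countable I" "I \<subseteq> D" "\<Union>(N ` I) = topspace X"
    by (metis countable_subset_image)
  moreover have "D \<subseteq> I"
  proof
    fix d assume "d \<in> D"
    then obtain i where "i \<in> I" "d \<in> N i" using \<open>\<Union>(N ` I) = topspace X\<close> sub by blast
    with \<open>d \<in> D\<close> show "d \<in> I" by (auto simp: N_def)
  qed
  ultimately show ?thesis by (metis countable_subset)
qed simp

section \<open>Thin sets\<close>

text \<open>Quantifying over all subsets makes thinness pass to uncountable subsets. Convergence to
  \<open>p\<close> is not demanded: in a Lindelof space uncountability forces it.\<close>

definition thin_to :: "'a topology \<Rightarrow> 'a set \<Rightarrow> 'a \<Rightarrow> bool" where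
  "thin_to X D p \<longleftrightarrow>
     D \<subseteq> topspace X \<and> uncountable D \<and> p \<in> topspace X - D \<and> (\<forall>E\<subseteq>D. X closure_of E \<subseteq> insert p E)"

lemma thin_to_subset: "thin_to X D p \<Longrightarrow> E \<subseteq> D \<Longrightarrow> uncountable E \<Longrightarrow> thin_to X E p"
  by (auto simp: thin_to_def dest: subset_trans)

text \<open>Subsets of \<open>D - U\<close> cannot accumulate at \<open>p\<close>, the only possible
  limit outside them, so all of them are closed.\<close>

lemma thin_to_countable_Diff:
  assumes "Lindelof_space X" and D: "thin_to X D p" and U: "openin X U" "p \<in> U"
  shows "countable (D - U)"
proof (rule Lindelof_space_discrete_closed_countable[OF assms(1)])
  fix E assume E: "E \<subseteq> D - U"
  then have "p \<notin> X closure_of E" using U by (auto simp: in_closure_of)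
  moreover have "X closure_of E \<subseteq> insert p E" using D E unfolding thin_to_def by blast
  ultimately show "closedin X E" using closure_of_subset_eq[of E X] E D unfolding thin_to_def by auto
qed

section \<open>Well-orders, disjoint refinements and the extraction of thin sets\<close>

lemma wf_total_on_UNIV:
  obtains r :: "'a rel" where "wf r" "total r"
proof -
  obtain r :: "'a rel" where "well_order r" using well_order_on by blast
  then show thesis
    using that[of "r - Id"]
    by (auto simp: well_order_on_def linear_order_on_def)
qed

text \<open>Take \<open>E\<close> itself or, if some initial segment of it is uncountable, a minimal
  such segment. With countable segments, a union of closed sets indexed by the predecessors of a
  point stays closed in a P-space.\<close>

lemma uncountable_subset_countable_segments:
  assumes "wf r" "uncountable E"
  obtains D where "D \<subseteq> E" "uncountable D" "\<And>d. d \<in> D \<Longrightarrow> countable {e \<in> D. (e, d) \<in> r}"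
proof (cases "\<exists>d\<in>E. uncountable {e \<in> E. (e, d) \<in> r}")
  case True
  then obtain d0 where d0: "d0 \<in> {d \<in> E. uncountable {e \<in> E. (e, d) \<in> r}}" by blast
  obtain d where d: "d \<in> E" "uncountable {e \<in> E. (e, d) \<in> r}"
    and min: "\<And>c. (c, d) \<in> r \<Longrightarrow> c \<in> E \<Longrightarrow> countable {e \<in> E. (e, c) \<in> r}"
    by (rule wfE_min[OF assms(1) d0]) blast
  show thesis
  proof (rule that[of "{e \<in> E. (e, d) \<in> r}"])
    fix c assume "c \<in> {e \<in> E. (e, d) \<in> r}"
    then show "countable {e \<in> {e \<in> E. (e, d) \<in> r}. (e, c) \<in> r}"
      using min[of c] by (auto elim!: countable_subset[rotated])
  qed (use d in auto)
qed (use that assms in blast)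

text \<open>Choose one point from each piece \<open>V i\<close> selected by a point of
  \<open>G\<close>. Countably many pieces cannot suffice: their closures would form a closed set
  containing \<open>G\<close> but not \<open>p\<close>.\<close>

lemma almost_closed_to_thin:
  assumes X: "Hausdorff_space X" "P_space X" and G: "almost_closed_to X G p"
    and V: "\<And>i. i \<in> I \<Longrightarrow> openin X (V i)" "\<And>i. i \<in> I \<Longrightarrow> p \<notin> X closure_of (V i)" "G \<subseteq> (\<Union>i\<in>I. V i)"
    and disj: "\<And>i j. \<lbrakk>i \<in> I; j \<in> I; i \<noteq> j\<rbrakk> \<Longrightarrow> V i \<inter> V j \<inter> G = {}"
  shows "\<exists>D\<subseteq>G. thin_to X D p"
proof -
  have G': "G \<subseteq> topspace X" "X closure_of G - G = {p}"
    using G by (auto simp: almost_closed_to_def)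
  obtain m where m: "\<And>g. g \<in> G \<Longrightarrow> m g \<in> I \<and> g \<in> V (m g)"
    using V(3) by (metis UN_iff subsetD)
  obtain D where D: "D \<subseteq> G" "m ` G = m ` D" "inj_on m D"
    using subset_image_inj[of "m ` G" m G] by auto
  have "uncountable D"
  proof
    assume "countable D"
    then have "countable (m ` G)" using D by simp
    then have "closedin X (\<Union>i\<in>m ` G. X closure_of V i)"
      using X by (intro closedin_P_space_UN) auto
    moreover have "G \<subseteq> (\<Union>i\<in>m ` G. X closure_of V i)"
      using m closure_of_subset[OF openin_subset[OF V(1)]] by blast
    ultimately have "X closure_of G \<subseteq> (\<Union>i\<in>m ` G. X closure_of V i)"
      by (rule closure_of_minimal[rotated])
    then show False using G'(2) m V(2) by blast
  qed
  moreover have "X closure_of E \<subseteq> insert p E" if E: "E \<subseteq> D" for E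
  proof
    fix q assume q: "q \<in> X closure_of E"
    show "q \<in> insert p E"
    proof (cases "q = p")
      case False
      then have "q \<in> G"
        using q G'(2) closure_of_mono[of E G X] E D by blast
      let ?V = "V (m q)"
      \<comment> \<open>The piece around \<open>q\<close> is open, so it suffices to look inside it;
        there \<open>E\<close> has only one point, by disjointness and injectivity of
        \<open>m\<close> on \<open>D\<close>.\<close>
      have "q \<in> X closure_of (?V \<inter> E)"
        using openin_Int_closure_of_subset[of X ?V E] q m[OF \<open>q \<in> G\<close>] V(1) by blast
      moreover have same: "m d = m q" if "d \<in> ?V \<inter> E" for d
        using disj[of "m d" "m q"] m[of d] m[OF \<open>q \<in> G\<close>] that E D by blast
      ultimately obtain d where d: "d \<in> ?V \<inter> E"
        by (metis closure_of_empty ex_in_conv)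
      then have "?V \<inter> E \<subseteq> {d}"
        using same D(3) E by (metis Int_iff inj_onD singletonI subsetD subsetI)
      moreover have "closedin X {d}"
        using d E D G' X(1) by (intro closedin_Hausdorff_singleton) auto
      ultimately have "X closure_of (?V \<inter> E) \<subseteq> {d}" by (rule closure_of_minimal)
      with \<open>q \<in> X closure_of (?V \<inter> E)\<close> d show ?thesis by auto
    qed simp
  qed
  moreover have "p \<in> topspace X - D" using G' D closure_of_subset_topspace[of X G] by blast
  moreover have "D \<subseteq> topspace X" using D(1) G'(1) by (rule subset_trans)
  ultimately have "thin_to X D p" by (simp add: thin_to_def)
  with D(1) show ?thesis by blast
qed

text \<open>\<open>V e\<close> is a clopen neighbourhood \<open>U e\<close> of \<open>e\<close> minus the closure of the part of \<open>F\<close> covered by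
  the earlier \<open>U d\<close>. Density holds since the first \<open>U e\<close> meeting an open set within \<open>F\<close> meets it
  inside \<open>V e\<close>.\<close>

lemma disjoint_refinement:
  fixes X :: "'a topology" and r :: "'a rel"
  assumes X: "Hausdorff_space X" "Lindelof_space X" "P_space X"
    and r: "wf r" "total r"
    and F: "F \<subseteq> topspace X" "p \<in> topspace X - F"
  shows "\<exists>V. (\<forall>e\<in>F. openin X (V e) \<and> p \<notin> X closure_of V e) \<and>
    (\<forall>d\<in>F. \<forall>e\<in>F. d \<noteq> e \<longrightarrow> V d \<inter> V e \<inter> F = {}) \<and>
    F \<subseteq> X closure_of (F \<inter> (\<Union>e\<in>F. V e)) \<and>
    ((\<forall>e\<in>F. countable {d \<in> F. (d, e) \<in> r}) \<longrightarrow> F \<subseteq> (\<Union>e\<in>F. V e))"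
proof -
  have "\<exists>U. openin X U \<and> closedin X U \<and> e \<in> U \<and> p \<notin> U" if "e \<in> F" for e
    using Lindelof_P_space_clopen_separation[OF X, of "{p}" e] closedin_Hausdorff_singleton[OF X(1), of p] F that
    by (metis DiffD1 DiffD2 DiffI disjoint_insert(1) singletonD subsetD)
  then obtain U where U: "\<And>e. e \<in> F \<Longrightarrow> openin X (U e) \<and> closedin X (U e) \<and> e \<in> U e \<and> p \<notin> U e"
    by metis
  define S where "S e = X closure_of (\<Union>d\<in>{d \<in> F. (d, e) \<in> r}. U d \<inter> F)" for e
  define V where "V e = U e - S e" for e
  have S: "U d \<inter> F \<subseteq> S e" if "(d, e) \<in> r" "d \<in> F" for d e
  proof -
    have "(\<Union>d\<in>{d \<in> F. (d, e) \<in> r}. U d \<inter> F) \<subseteq> S e"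
      unfolding S_def using F by (intro closure_of_subset) auto
    with that show ?thesis by blast
  qed
  show ?thesis
  proof (intro exI[of _ V] conjI ballI impI)
    fix e assume e: "e \<in> F"
    show "openin X (V e)" using U[OF e] by (auto simp: V_def S_def intro!: openin_diff)
    have "X closure_of V e \<subseteq> U e" using U[OF e] by (intro closure_of_minimal) (auto simp: V_def)
    then show "p \<notin> X closure_of V e" using U[OF e] by auto
  next
    fix d e assume "d \<in> F" "e \<in> F" "d \<noteq> e"
    moreover from \<open>d \<noteq> e\<close> have "(d, e) \<in> r \<or> (e, d) \<in> r"
      using r(2) by (simp add: total_on_def)
    ultimately show "V d \<inter> V e \<inter> F = {}"
      using S[of d e] S[of e d] by (auto simp: V_def)
  next
    show "F \<subseteq> X closure_of (F \<inter> (\<Union>e\<in>F. V e))"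
    proof
      fix f assume f: "f \<in> F"
      have "\<exists>y. y \<in> F \<inter> (\<Union>e\<in>F. V e) \<and> y \<in> W" if W: "f \<in> W" "openin X W" for W
      proof -
        have *: "f \<in> {e \<in> F. U e \<inter> W \<inter> F \<noteq> {}}" using f U W by auto
        obtain e where e: "e \<in> F" "U e \<inter> W \<inter> F \<noteq> {}"
          and min: "\<And>d. (d, e) \<in> r \<Longrightarrow> d \<in> F \<Longrightarrow> U d \<inter> W \<inter> F = {}"
          by (rule wfE_min[OF r(1) *]) blast
        have "W \<inter> S e = {}"
          unfolding S_def openin_Int_closure_of_eq_empty[OF W(2)] using min by blast
        with e show ?thesis by (auto simp: V_def)
      qed
      with f F show "f \<in> X closure_of (F \<inter> (\<Union>e\<in>F. V e))" by (auto simp: in_closure_of)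
    qed
  next
    assume c: "\<forall>e\<in>F. countable {d \<in> F. (d, e) \<in> r}"
    show "F \<subseteq> (\<Union>e\<in>F. V e)"
    proof
      fix f assume f: "f \<in> F"
      then have *: "f \<in> {e \<in> F. f \<in> U e}" using U by auto
      obtain e where e: "e \<in> F" "f \<in> U e" and min: "\<And>d. (d, e) \<in> r \<Longrightarrow> d \<in> F \<Longrightarrow> f \<notin> U d"
        by (rule wfE_min[OF r(1) *]) blast
      \<comment> \<open>With countably many predecessors the union of the earlier \<open>U d\<close>
        is already closed, so \<open>S e\<close> adds no points beyond it and the first
        \<open>U e\<close> containing \<open>f\<close> keeps \<open>f\<close> in
        \<open>V e\<close>.\<close>
      have "closedin X (\<Union>d\<in>{d \<in> F. (d, e) \<in> r}. U d)"
        using c e(1) U by (intro closedin_P_space_UN X) auto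
      then have "S e \<subseteq> (\<Union>d\<in>{d \<in> F. (d, e) \<in> r}. U d)"
        unfolding S_def by (intro closure_of_minimal) auto
      then show "f \<in> (\<Union>e\<in>F. V e)" using e min by (auto simp: V_def)
    qed
  qed
qed

lemma Whyburn_thin:
  assumes X: "Hausdorff_space X" "Lindelof_space X" "P_space X" "Whyburn_space X"
    and P: "P \<subseteq> topspace X" "x \<in> X closure_of P - P"
  obtains D where "D \<subseteq> P" "thin_to X D x"
proof -
  have W: "\<exists>F\<subseteq>A. almost_closed_to X F x" if "A \<subseteq> topspace X" "x \<in> X closure_of A - A" for A
  proof -
    have "\<not> closedin X A" using that(2) closure_of_closedin[of X A] by auto
    with X(4) that show ?thesis unfolding Whyburn_space_def by blast
  qed
  obtain F where F: "F \<subseteq> P" "almost_closed_to X F x" using W[OF P] by blast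
  then have F': "F \<subseteq> topspace X" "x \<in> topspace X - F" "x \<in> X closure_of F"
    using closure_of_subset_topspace[of X F] by (auto simp: almost_closed_to_def)
  obtain r :: "'a rel" where r: "wf r" "total r"
    using wf_total_on_UNIV by blast
  obtain V where V: "\<forall>e\<in>F. openin X (V e) \<and> x \<notin> X closure_of V e"
    "\<forall>d\<in>F. \<forall>e\<in>F. d \<noteq> e \<longrightarrow> V d \<inter> V e \<inter> F = {}"
    "F \<subseteq> X closure_of (F \<inter> (\<Union>e\<in>F. V e))"
    using disjoint_refinement[OF X(1-3) r F'(1,2)] by (elim exE conjE)
  let ?A = "F \<inter> (\<Union>e\<in>F. V e)"
  \<comment> \<open>By density \<open>x\<close> is still a limit of \<open>?A\<close>, and the
    Whyburn property gives convergence to this same \<open>x\<close>, which the pieces were built to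
    avoid.\<close>
  have "X closure_of F \<subseteq> X closure_of ?A" using V(3) by (intro closure_of_minimal) auto
  then obtain G where G: "G \<subseteq> ?A" "almost_closed_to X G x"
    using W[of ?A] F' by blast
  have GF: "G \<subseteq> F" "G \<subseteq> (\<Union>e\<in>F. V e)" using G(1) by auto
  have "\<exists>D\<subseteq>G. thin_to X D x"
    by (rule almost_closed_to_thin[OF X(1,3) G(2) _ _ GF(2)]) (use V(1,2) GF(1) in fast)+
  then obtain D where "D \<subseteq> G" "thin_to X D x" by blast
  with GF(1) F(1) show thesis by (intro that[of D]) auto
qed

text \<open>Here the limit cannot be prescribed, so \<open>F\<close> and \<open>y\<close> are fixed
  before the pieces are built around them. Countable segments then make the pieces cover all of
  \<open>F\<close>, so there is no need to shrink \<open>F\<close> and risk another limit.\<close>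

lemma weakly_Whyburn_thin:
  assumes Y: "Hausdorff_space Y" "Lindelof_space Y" "P_space Y" "weakly_Whyburn_space Y"
    and E: "E \<subseteq> topspace Y" "uncountable E"
  obtains D y where "D \<subseteq> E" "thin_to Y D y"
proof -
  obtain r :: "'a rel" where r: "wf r" "total r"
    using wf_total_on_UNIV by blast
  obtain E1 where E1: "E1 \<subseteq> E" "uncountable E1" "\<And>d. d \<in> E1 \<Longrightarrow> countable {e \<in> E1. (e, d) \<in> r}"
    using uncountable_subset_countable_segments[OF r(1) E(2)] by blast
  obtain E2 where E2: "E2 \<subseteq> E1" "\<not> closedin Y E2"
    using Lindelof_space_discrete_closed_countable[OF Y(2), of E1] E1(2) by blast
  moreover have "E2 \<subseteq> topspace Y" using E2 E1 E by blast
  ultimately obtain y F where F: "F \<subseteq> E2" "almost_closed_to Y F y"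
    using Y(4) unfolding weakly_Whyburn_space_def by blast
  then have F': "F \<subseteq> topspace Y" "y \<in> topspace Y - F"
    using closure_of_subset_topspace[of Y F] by (auto simp: almost_closed_to_def)
  have "countable {d \<in> F. (d, e) \<in> r}" if "e \<in> F" for e
    by (rule countable_subset[OF _ E1(3)[of e]]) (use that F E2 in auto)
  then have cF: "\<forall>e\<in>F. countable {d \<in> F. (d, e) \<in> r}" by (rule ballI)
  obtain V where V: "\<forall>e\<in>F. openin Y (V e) \<and> y \<notin> Y closure_of V e"
    "\<forall>d\<in>F. \<forall>e\<in>F. d \<noteq> e \<longrightarrow> V d \<inter> V e \<inter> F = {}"
    "(\<forall>e\<in>F. countable {d \<in> F. (d, e) \<in> r}) \<longrightarrow> F \<subseteq> (\<Union>e\<in>F. V e)"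
    using disjoint_refinement[OF Y(1-3) r F'] by (elim exE conjE)
  have "\<exists>D\<subseteq>F. thin_to Y D y"
    by (rule almost_closed_to_thin[OF Y(1,3) F(2) _ _ mp[OF V(3) cF]]) (use V(1,2) in fast)+
  then obtain D where "D \<subseteq> F" "thin_to Y D y" by blast
  with F(1) E1(1) E2(1) show thesis by (intro that[of D y]) auto
qed

section \<open>Products\<close>

lemma almost_closed_to_Pair_right:
  assumes "Hausdorff_space X" "x \<in> topspace X" "almost_closed_to Y F y"
  shows "almost_closed_to (prod_topology X Y) ({x} \<times> F) (x, y)"
proof -
  have "X closure_of {x} = {x}"
    using assms(1,2) closedin_Hausdorff_singleton closure_of_closedin by metis
  with assms show ?thesis
    by (auto simp: almost_closed_to_def closure_of_Times)
qed

lemma almost_closed_to_Pair_left: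
  assumes "Hausdorff_space Y" "y \<in> topspace Y" "almost_closed_to X F x"
  shows "almost_closed_to (prod_topology X Y) (F \<times> {y}) (x, y)"
proof -
  have "Y closure_of {y} = {y}"
    using assms(1,2) closedin_Hausdorff_singleton closure_of_closedin by metis
  with assms show ?thesis
    by (auto simp: almost_closed_to_def closure_of_Times)
qed

text \<open>A neighbourhood of \<open>p\<close> misses only countably many points of the uncountable
  set \<open>D\<close>.\<close>

lemma thin_to_imp_almost_closed_to:
  assumes "Lindelof_space X" "thin_to X D p"
  shows "almost_closed_to X D p"
proof -
  have D: "D \<subseteq> topspace X" "uncountable D" "p \<in> topspace X - D" "X closure_of D \<subseteq> insert p D"
    using assms(2) by (auto simp: thin_to_def)
  have "\<exists>d. d \<in> D \<and> d \<in> U" if "p \<in> U" "openin X U" for U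
  proof -
    have "countable (D - U)" using thin_to_countable_Diff[OF assms that(2,1)] .
    then have "D - U \<noteq> D" using D(2) by metis
    then show ?thesis by blast
  qed
  then have "p \<in> X closure_of D" using D by (auto simp: in_closure_of)
  with D show ?thesis using closure_of_subset[OF D(1)] by (auto simp: almost_closed_to_def)
qed

lemma almost_closed_to_thin_graph:
  assumes X: "Hausdorff_space X" "Lindelof_space X" and Y: "Hausdorff_space Y" "Lindelof_space Y"
    and D: "thin_to X (g ` E) x" "thin_to Y E y" and inj: "inj_on g E"
  shows "almost_closed_to (prod_topology X Y) ((\<lambda>e. (g e, e)) ` E) (x, y)"
proof -
  let ?Z = "prod_topology X Y" and ?S = "(\<lambda>e. (g e, e)) ` E"
  have tX: "g ` E \<subseteq> topspace X" "x \<in> topspace X - g ` E" "\<And>T. T \<subseteq> g ` E \<Longrightarrow> X closure_of T \<subseteq> insert x T"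
    and tY: "E \<subseteq> topspace Y" "y \<in> topspace Y - E" "\<And>T. T \<subseteq> E \<Longrightarrow> Y closure_of T \<subseteq> insert y T"
    and unc: "uncountable E"
    using D by (auto simp: thin_to_def)
  have S: "?S \<subseteq> topspace ?Z" using tX(1) tY(1) by auto
  have sub: "(a, b) \<in> insert (x, y) ?S" if ab: "(a, b) \<in> ?Z closure_of ?S" for a b
  proof -
    have split: "(a, b) = (g e, e) \<or> (a, b) \<in> (X closure_of (g ` (E - {e}))) \<times> (Y closure_of (E - {e}))"
      if e: "e \<in> E" for e
    proof -
      have "?S \<subseteq> {(g e, e)} \<union> g ` (E - {e}) \<times> (E - {e})" by auto
      then have "?Z closure_of ?S \<subseteq> ?Z closure_of ({(g e, e)} \<union> g ` (E - {e}) \<times> (E - {e}))"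
        by (rule closure_of_mono)
      also have "\<dots> = ?Z closure_of {(g e, e)} \<union> (X closure_of (g ` (E - {e}))) \<times> (Y closure_of (E - {e}))"
        unfolding closure_of_Un closure_of_Times ..
      also have "?Z closure_of {(g e, e)} = {(g e, e)}"
        using e S X Y by (intro closure_of_closedin closedin_Hausdorff_singleton)
          (auto simp: Hausdorff_space_prod_topology)
      finally show ?thesis using ab by blast
    qed
    have "?S \<subseteq> g ` E \<times> E" by auto
    then have "?Z closure_of ?S \<subseteq> (X closure_of (g ` E)) \<times> (Y closure_of E)"
      by (metis closure_of_Times closure_of_mono)
    then have "a \<in> insert x (g ` E)" "b \<in> insert y E"
      using ab tX(3)[of "g ` E"] tY(3)[of E] by auto
    then consider "(a, b) = (x, y)" | e where "e \<in> E" "a = g e" | "b \<in> E" by blast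
    then show ?thesis
    proof cases
      case (2 e)
      have "X closure_of (g ` (E - {e})) \<subseteq> insert x (g ` (E - {e}))" by (intro tX(3)) auto
      moreover have "g e \<notin> insert x (g ` (E - {e}))"
        using 2(1) tX(2) inj by (auto simp: inj_on_def)
      ultimately show ?thesis using split[OF 2(1)] 2 by auto
    next
      case 3
      have "Y closure_of (E - {b}) \<subseteq> insert y (E - {b})" by (intro tY(3)) auto
      with split[OF 3] 3 tY(2) show ?thesis by auto
    qed auto
  qed
  moreover have "(x, y) \<in> ?Z closure_of ?S"
    unfolding in_closure_of
  proof (intro conjI allI impI)
    show "(x, y) \<in> topspace ?Z" using tX(2) tY(2) by auto
    fix T assume "(x, y) \<in> T \<and> openin ?Z T"
    then obtain U W where UW: "openin X U" "openin Y W" "x \<in> U" "y \<in> W" "U \<times> W \<subseteq> T"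
      unfolding openin_prod_topology_alt by blast
    have "countable (g ` E - U)" by (rule thin_to_countable_Diff[OF X(2) D(1) UW(1,3)])
    \<comment> \<open>Injectivity of \<open>g\<close> carries countability from the values outside
      \<open>U\<close> back to the indices; hence \<open>U \<times> W\<close> misses only countably
      many points of the graph.\<close>
    moreover have "g ` {e \<in> E. g e \<notin> U} = g ` E - U" by auto
    ultimately have "countable {e \<in> E. g e \<notin> U}"
      using inj by (metis (no_types, lifting) countable_image_inj_on inj_on_subset mem_Collect_eq subsetI)
    moreover have "countable (E - W)" by (rule thin_to_countable_Diff[OF Y(2) D(2) UW(2,4)])
    ultimately have "countable ({e \<in> E. g e \<notin> U} \<union> (E - W))" by simp
    then have "\<not> E \<subseteq> {e \<in> E. g e \<notin> U} \<union> (E - W)" using unc countable_subset by blast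
    then show "\<exists>z. z \<in> ?S \<and> z \<in> T" using UW(5) by blast
  qed
  moreover have "(x, y) \<notin> ?S" using tY(2) by auto
  ultimately show ?thesis
    using closure_of_subset[OF S] S unfolding almost_closed_to_def by auto
qed

section \<open>Convergence out of a non-closed set in the product\<close>

theorem corollary24:
  fixes X :: "'a topology" and Y :: "'b topology"
  assumes "Hausdorff_space X" and "Lindelof_space X" and "P_space X" and "Whyburn_space X"
    and "Hausdorff_space Y" and "Lindelof_space Y" and "P_space Y" and "weakly_Whyburn_space Y"
  shows "weakly_Whyburn_space (prod_topology X Y)"
  unfolding weakly_Whyburn_space_def
proof (intro allI impI, elim conjE)
  note X = assms(1-4) and Y = assms(5-8)
  let ?Z = "prod_topology X Y"
  fix A assume A: "A \<subseteq> topspace ?Z" "\<not> closedin ?Z A"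
  let ?concl = "\<exists>z \<in> ?Z closure_of A - A. \<exists>F \<subseteq> A. almost_closed_to ?Z F z"
  \<comment> \<open>A limit of a subset of \<open>A\<close> lies in the closure of \<open>A\<close>,
    so each case only has to place its limit outside \<open>A\<close>.\<close>
  have goal: ?concl if "F \<subseteq> A" "almost_closed_to ?Z F z" "z \<notin> A" for F z
  proof -
    have "z \<in> ?Z closure_of A"
      using that closure_of_mono[of F A ?Z] by (auto simp: almost_closed_to_def)
    with that show ?thesis by blast
  qed
  obtain x y where xy: "(x, y) \<in> ?Z closure_of A" "(x, y) \<notin> A"
    using A closure_of_subset_eq by fastforce
  then have xy': "x \<in> topspace X" "y \<in> topspace Y"
    using closure_of_subset_topspace[of ?Z A] by auto
  define B where "B = {b. (x, b) \<in> A}"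
  have B: "B \<subseteq> topspace Y" using A by (auto simp: B_def)
  show ?concl
  proof (cases "closedin Y B")
    case False
    then obtain b F where F: "b \<in> Y closure_of B - B" "F \<subseteq> B" "almost_closed_to Y F b"
      using Y(4) B unfolding weakly_Whyburn_space_def by blast
    show ?thesis
      by (rule goal[OF _ almost_closed_to_Pair_right[OF X(1) xy'(1) F(3)]])
        (use F in \<open>auto simp: B_def\<close>)
  next
    case True
    have "y \<in> topspace Y - B" using xy xy' by (auto simp: B_def)
    then obtain V where V: "openin Y V" "closedin Y V" "y \<in> V" "V \<inter> B = {}"
      using Lindelof_P_space_clopen_separation[OF Y(1-3) True] by metis
    define P where "P = fst ` (A \<inter> (topspace X \<times> V))"
    have P: "P \<subseteq> topspace X" by (auto simp: P_def)
    have "x \<in> X closure_of P"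
      unfolding in_closure_of
    proof (intro conjI allI impI xy')
      fix U assume U: "x \<in> U \<and> openin X U"
      then have "openin ?Z (U \<times> V)" "(x, y) \<in> U \<times> V"
        using V by (auto simp: openin_prod_Times_iff)
      then obtain a b where ab: "(a, b) \<in> A" "a \<in> U" "b \<in> V"
        using xy(1) unfolding in_closure_of by (metis mem_Sigma_iff surj_pair)
      then have "a \<in> P" using A(1) unfolding P_def by (intro image_eqI[of _ _ "(a, b)"]) auto
      with ab show "\<exists>a. a \<in> P \<and> a \<in> U" by blast
    qed
    moreover have "x \<notin> P" using V(4) by (auto simp: P_def B_def)
    ultimately obtain D where D: "D \<subseteq> P" "thin_to X D x"
      using Whyburn_thin[OF X P] by blast
    have "\<exists>b. (d, b) \<in> A \<and> b \<in> V" if "d \<in> D" for d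
      using that D(1) by (force simp: P_def)
    then obtain f where f: "\<And>d. d \<in> D \<Longrightarrow> (d, f d) \<in> A \<and> f d \<in> V" by metis
    \<comment> \<open>All limits found below have first coordinate \<open>x\<close> and second
      coordinate in \<open>V\<close>, which misses the section \<open>B\<close>.\<close>
    have notA: "(x, b) \<notin> A" if "b \<in> V" for b using that V(4) by (auto simp: B_def)
    have "uncountable D" using D(2) by (simp add: thin_to_def)
    show ?thesis
    proof (cases "\<exists>b\<in>f ` D. uncountable {d \<in> D. f d = b}")
      case True
      then obtain b where b: "b \<in> f ` D" "uncountable {d \<in> D. f d = b}" by blast
      then have "b \<in> V" using f by blast
      have "thin_to X {d \<in> D. f d = b} x" by (rule thin_to_subset[OF D(2) _ b(2)]) auto
      then have "almost_closed_to X {d \<in> D. f d = b} x"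
        by (rule thin_to_imp_almost_closed_to[OF X(2)])
      then have "almost_closed_to ?Z ({d \<in> D. f d = b} \<times> {b}) (x, b)"
        using \<open>b \<in> V\<close> openin_subset[OF V(1)] by (intro almost_closed_to_Pair_left[OF Y(1)]) auto
      then show ?thesis by (rule goal[rotated]) (use f notA[OF \<open>b \<in> V\<close>] in auto)
    next
      case False
      have "uncountable (f ` D)"
      proof
        assume "countable (f ` D)"
        then have "countable (\<Union>b\<in>f ` D. {d \<in> D. f d = b})" using False by (intro countable_UN) auto
        moreover have "(\<Union>b\<in>f ` D. {d \<in> D. f d = b}) = D" by auto
        ultimately show False using \<open>uncountable D\<close> by simp
      qed
      moreover have "f ` D \<subseteq> topspace Y" using f openin_subset[OF V(1)] by blast
      ultimately obtain E z where E: "E \<subseteq> f ` D" "thin_to Y E z"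
        using weakly_Whyburn_thin[OF Y, of "f ` D"] by blast
      then have "almost_closed_to Y E z" using thin_to_imp_almost_closed_to[OF Y(2)] by blast
      \<comment> \<open>Closedness of \<open>V\<close> keeps the limit \<open>z\<close>, over which
        there is no control, inside \<open>V\<close>.\<close>
      moreover have "Y closure_of E \<subseteq> V" using E f V(2) by (intro closure_of_minimal) auto
      ultimately have "z \<in> V" by (auto simp: almost_closed_to_def)
      \<comment> \<open>One point of \<open>D\<close> is picked from each fibre of \<open>f\<close>
        over \<open>E\<close>, so the points \<open>(g e, e)\<close> belong to
        \<open>A\<close>.\<close>
      define g where "g = inv_into D f"
      have g: "g e \<in> D" "f (g e) = e" if "e \<in> E" for e
        using that E(1) by (auto simp: g_def inv_into_into f_inv_into_f)
      have inj: "inj_on g E" unfolding g_def using E(1) by (rule inj_on_inv_into)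
      have "uncountable (g ` E)"
        using E(2) countable_image_inj_on[OF _ inj] by (auto simp: thin_to_def)
      then have "thin_to X (g ` E) x" using g by (intro thin_to_subset[OF D(2)]) auto
      then have "almost_closed_to ?Z ((\<lambda>e. (g e, e)) ` E) (x, z)"
        by (rule almost_closed_to_thin_graph[OF X(1,2) Y(1,2) _ E(2) inj])
      then show ?thesis by (rule goal[rotated]) (use f g notA[OF \<open>z \<in> V\<close>] in force)+
    qed
  qed
qed

end
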